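(* Let $(X,d)$ be a Ptolemy space, and let $D\subsetneq X$ be an open set with $\partial D\neq\emptyset$. Then the function defined for all $x,y\in D$ by $$\tilde c_D(x,y)=\sup_{p\in\partial D}\frac{d(x,y)}{\max\{d(x,p),d(y,p)\}}$$ is a metric on $D$.
   Context: A metric space $(X,d)$ is called a Ptolemy space if for all $x,y,z,w\in X$ the Ptolemy inequality $d(x,y)\,d(z,w)\le d(x,z)\,d(y,w)+d(x,w)\,d(y,z)$ holds. $\partial D$ denotes the boundary of $D$ in $X$. *)

theory Defs
  imports "HOL-Analysis.Analysis"
begin

locale Ptolemy_space = Metric_space +
  assumes ptolemy:
    "\<lbrakk>x \<in> M; y \<in> M; z \<in> M; w \<in> M\<rbrakk> \<Longrightarrow> d x y * d z w \<le> d x z * d y w + d x w * d y z"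

context Metric_space
begin

(* The function is only meant on D. It is extended by 0 because the locale Metric_space
   asks for symmetry and nonnegativity of the distance function on the whole type. *)
definition c_tilde :: "'a set \<Rightarrow> 'a \<Rightarrow> 'a \<Rightarrow> real" where
  "c_tilde D x y =
    (if x \<in> D \<and> y \<in> D
     then (SUP p \<in> mtopology frontier_of D. d x y / max (d x p) (d y p))
     else 0)"

(* The next two facts show that neither division by zero nor the supremum of an
   unbounded set of reals occurs in c_tilde. *)

lemma c_tilde_denominator_pos:
  assumes "openin mtopology D" "x \<in> D" "p \<in> mtopology frontier_of D"
  shows "0 < max (d x p) (d y p)"
proof -
  have "D \<subseteq> M" using openin_subset[OF assms(1)] by simp
  moreover have "p \<in> M"
    using assms(3) frontier_of_subset_topspace[of mtopology D] by auto
  moreover have "p \<notin> D"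
    using assms(1,3) by (auto simp: frontier_of_def interior_of_openin)
  ultimately have "0 < d x p" using assms(2) by (intro mdist_pos_less) auto
  then show ?thesis by simp
qed

lemma c_tilde_bdd_above:
  assumes "openin mtopology D" "x \<in> D" "y \<in> D"
  shows "bdd_above ((\<lambda>p. d x y / max (d x p) (d y p)) ` (mtopology frontier_of D))"
proof (rule bdd_aboveI2)
  fix p assume p: "p \<in> mtopology frontier_of D"
  have pos: "0 < max (d x p) (d y p)"
    using assms p by (intro c_tilde_denominator_pos)
  have "D \<subseteq> M" using openin_subset[OF assms(1)] by simp
  then have "x \<in> M" "p \<in> M" "y \<in> M"
    using assms(2,3) p frontier_of_subset_topspace[of mtopology D] by auto
  then have "d x y \<le> d x p + d y p" by (rule triangle'[of x p y])
  also have "\<dots> \<le> 2 * max (d x p) (d y p)" by simp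
  finally show "d x y / max (d x p) (d y p) \<le> 2" using pos by (simp add: divide_le_eq)
qed

end

end

theory Submission
  imports Defs
begin

text \<open>
  The triangle inequality holds already for each boundary point \<open>p\<close> separately. It follows from
  the triangle inequality of \<open>d\<close> unless the middle point \<open>y\<close> is farther from \<open>p\<close> than both
  \<open>x\<close> and \<open>z\<close>; then all fractions on the right have denominator \<open>d y p\<close>, and the Ptolemy
  inequality for \<open>x, z, y, p\<close> applies.
\<close>

lemma divide_max_triangle:
  fixes a b c u v w :: real
  assumes pos: "0 < a" "0 < b" "0 < c" and nonneg: "0 \<le> u" "0 \<le> v"
    and triangle: "w \<le> u + v" and ptolemy: "w * b \<le> u * c + v * a"
  shows "w / max a c \<le> u / max a b + v / max b c"
proof -
  \<comment> \<open>Here \<open>a\<close>, \<open>b\<close>, \<open>c\<close> stand for the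
    distances of x, y, z to p, and \<open>u\<close>, \<open>v\<close>, \<open>w\<close> for those of
    the pairs xy, yz, xz. Exchanging x and z swaps \<open>a\<close> with \<open>c\<close> and
    \<open>u\<close> with \<open>v\<close> but fixes \<open>b\<close> and \<open>w\<close>;
    generalising over the swapped variables lets the case \<open>c \<le> a\<close> serve for both
    orders.\<close>
  have *: "w / a \<le> u / max a b + v / max b c"
    if "c \<le> a" "0 < a" "0 < b" "0 < c" "0 \<le> u" "0 \<le> v" "w \<le> u + v" "w * b \<le> u * c + v * a"
    for a c u v :: real
  proof (cases "b \<le> a")
    case True
    have "w / a \<le> u / a + v / a"
      using that by (simp add: divide_right_mono flip: add_divide_distrib)
    \<comment> \<open>Both \<open>b\<close> and \<open>c\<close> are at most \<open>a\<close>, so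
      passing to the smaller denominator enlarges the fraction.\<close>
    also have "v / a \<le> v / max b c"
      using that True by (intro divide_left_mono) auto
    finally show ?thesis using True by (simp add: max_def)
  next
    case False
    \<comment> \<open>Now \<open>b\<close> exceeds \<open>a\<close> and \<open>c\<close>. Weakening
      \<open>c\<close> to \<open>a\<close> in the Ptolemy bound yields the common factor
      \<open>a\<close>; dividing by \<open>a * b\<close> gives the claim.\<close>
    have "w * b \<le> u * a + v * a"
      using that mult_left_mono[of c a u] by linarith
    then have "w / a \<le> (u + v) / b"
      using that by (simp add: field_simps)
    then show ?thesis
      using that False by (simp add: max_def add_divide_distrib)
  qed
  show ?thesis
  proof (cases "c \<le> a")
    case True
    then show ?thesis using * assms by (simp add: max_def)
  next
    case False
    then have "w / c \<le> v / max c b + u / max b a"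
      using assms by (intro *) (auto simp: algebra_simps)
    then show ?thesis using False by (simp add: max.commute[of c b] max.commute[of b a] max.absorb2 add.commute)
  qed
qed

context Metric_space
begin

lemma c_tilde_upper:
  assumes "openin mtopology D" "x \<in> D" "y \<in> D" "p \<in> mtopology frontier_of D"
  shows "d x y / max (d x p) (d y p) \<le> c_tilde D x y"
  using assms c_tilde_bdd_above[OF assms(1-3)] by (auto simp: c_tilde_def intro: cSUP_upper)

lemma c_tilde_least:
  assumes "mtopology frontier_of D \<noteq> {}" "x \<in> D" "y \<in> D"
    and "\<And>p. p \<in> mtopology frontier_of D \<Longrightarrow> d x y / max (d x p) (d y p) \<le> B"
  shows "c_tilde D x y \<le> B"
  using assms by (auto simp: c_tilde_def intro: cSUP_least)

lemma c_tilde_commute: "c_tilde D x y = c_tilde D y x"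
  by (simp add: c_tilde_def commute max.commute)

text \<open>One boundary point suffices: its quotient is positive and the supremum dominates
  it.\<close>

lemma c_tilde_pos:
  assumes "openin mtopology D" "mtopology frontier_of D \<noteq> {}" "x \<in> D" "y \<in> D" "x \<noteq> y"
  shows "0 < c_tilde D x y"
proof -
  obtain p where p: "p \<in> mtopology frontier_of D" using assms(2) by blast
  have "x \<in> M" "y \<in> M" using assms openin_subset[OF assms(1)] by auto
  then have "0 < d x y / max (d x p) (d y p)"
    using assms(5) c_tilde_denominator_pos[OF assms(1,3) p] by (simp add: mdist_pos_eq)
  also have "\<dots> \<le> c_tilde D x y" using assms p by (intro c_tilde_upper)
  finally show ?thesis .
qed

lemma c_tilde_refl:
  assumes "openin mtopology D" "mtopology frontier_of D \<noteq> {}" "x \<in> D"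
  shows "c_tilde D x x = 0"
proof -
  have "x \<in> M" using assms openin_subset[OF assms(1)] by auto
  \<comment> \<open>All quotients are 0, and a constant has itself as supremum because the boundary
    is nonempty.\<close>
  then show ?thesis using assms by (simp add: c_tilde_def)
qed

end

context Ptolemy_space
begin

text \<open>Each quotient for x, z is bounded at its own p by the two quotients at the same p, and
  these by their suprema.\<close>

lemma c_tilde_triangle:
  assumes "openin mtopology D" "mtopology frontier_of D \<noteq> {}" "x \<in> D" "y \<in> D" "z \<in> D"
  shows "c_tilde D x z \<le> c_tilde D x y + c_tilde D y z"
proof (rule c_tilde_least)
  fix p assume p: "p \<in> mtopology frontier_of D"
  have M: "x \<in> M" "y \<in> M" "z \<in> M" "p \<in> M"
    using assms openin_subset[OF assms(1)] p frontier_of_subset_topspace[of mtopology D] by auto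
  \<comment> \<open>With both points equal to \<open>q\<close>, the maximum in the denominator
    collapses to \<open>d q p\<close>.\<close>
  have pos: "0 < d q p" if "q \<in> D" for q
    using c_tilde_denominator_pos[OF assms(1) that p, of q] by simp
  have "d x z * d y p \<le> d x y * d z p + d y z * d x p"
    using ptolemy[of x z y p] M by (simp add: commute mult.commute)
  then have "d x z / max (d x p) (d z p)
      \<le> d x y / max (d x p) (d y p) + d y z / max (d y p) (d z p)"
    using assms(3-5) M by (intro divide_max_triangle triangle pos nonneg)
  also have "\<dots> \<le> c_tilde D x y + c_tilde D y z"
    using assms p by (intro add_mono c_tilde_upper)
  finally show "d x z / max (d x p) (d z p) \<le> c_tilde D x y + c_tilde D y z" .
qed (use assms in auto)

lemma Metric_space_c_tilde:
  assumes "openin mtopology D" "mtopology frontier_of D \<noteq> {}"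
  shows "Metric_space D (c_tilde D)"
proof
  show "0 \<le> c_tilde D x y" for x y
  proof (cases "x \<in> D \<and> y \<in> D")
    case True
    then show ?thesis
      using c_tilde_pos[OF assms, of x y] c_tilde_refl[OF assms, of x] by (cases "x = y") auto
  qed (auto simp: c_tilde_def)
  show "c_tilde D x y = c_tilde D y x" for x y
    by (rule c_tilde_commute)
  show "c_tilde D x y = 0 \<longleftrightarrow> x = y" if "x \<in> D" "y \<in> D" for x y
    using c_tilde_pos[OF assms that] c_tilde_refl[OF assms that(1)] by (cases "x = y") auto
  show "c_tilde D x z \<le> c_tilde D x y + c_tilde D y z" if "x \<in> D" "y \<in> D" "z \<in> D" for x y z
    using assms that by (rule c_tilde_triangle)
qed

end

theorem theorem1:
  fixes X :: "'a set" and d :: "'a \<Rightarrow> 'a \<Rightarrow> real" and D :: "'a set"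
  assumes "Ptolemy_space X d"
    and "openin (Metric_space.mtopology X d) D"
    and "D \<subset> X"
    and "(Metric_space.mtopology X d) frontier_of D \<noteq> {}"
  shows "Metric_space D (Metric_space.c_tilde X d D)"
  using assms(1,2,4) by (rule Ptolemy_space.Metric_space_c_tilde)

end
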